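(* Let $q$ be a prime power, let $m,n\ge 1$, and let $\mathcal{C}$ be an $[n,k,d]_{q^m/q}$ code. If $2d>n$, then $\mathcal{C}$ is rank-metric intersecting.
   Context: Support and rank: fix an $\mathbb{F}_q$-basis $\Gamma$ of $\mathbb{F}_{q^m}$. For $x=(x_1,\dots,x_n)\in\mathbb{F}_{q^m}^n$ let $\mathrm{Mat}_\Gamma(x)\in\mathbb{F}_q^{m\times n}$ be the matrix whose $j$-th column is the coordinate vector of $x_j$ in the basis $\Gamma$. The support $\sigma(x)\subseteq\mathbb{F}_q^n$ is the $\mathbb{F}_q$-row space of $\mathrm{Mat}_\Gamma(x)$, and $\mathrm{rk}(x)=\dim_{\mathbb{F}_q}\sigma(x)$; both are independent of $\Gamma$. An $[n,k,d]_{q^m/q}$ code is an $\mathbb{F}_{q^m}$-linear subspace $\mathcal{C}$ of $\mathbb{F}_{q^m}^n$ with $k=\dim_{\mathbb{F}_{q^m}}\mathcal{C}\ge 1$ and minimum distance $d=\min_{c\in\mathcal{C}\setminus\{0\}}\mathrm{rk}(c)$. The code is rank-metric intersecting if $\sigma(c)\cap\sigma(c')\ne\{0\}$ for all $c,c'\in\mathcal{C}\setminus\{0\}$. *)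

theory Defs
  imports "HOL-Analysis.Analysis"
begin

(* The extension F_{q^m}/F_q is a homomorphism iota from a finite field 'k (= F_q) to a finite
   field 'l (= F_{q^m}); it is injective because 'k is a field and iota 1 = 1. Vectors of length n
   are 'l^'n with CARD('n) = n; both m and n are positive because all types are inhabited. *)

definition field_embedding :: "('k::field \<Rightarrow> 'l::field) \<Rightarrow> bool" where
  "field_embedding \<iota> \<longleftrightarrow>
     \<iota> 1 = 1 \<and> (\<forall>a b. \<iota> (a + b) = \<iota> a + \<iota> b) \<and> (\<forall>a b. \<iota> (a * b) = \<iota> a * \<iota> b)"

definition ext_scale :: "('k::field \<Rightarrow> 'l::field) \<Rightarrow> 'k \<Rightarrow> 'l \<Rightarrow> 'l" where
  "ext_scale \<iota> a x = \<iota> a * x"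

(* The library constants module.span, module.dependent and module.representation used below have
   their intended meaning only for a scaling that makes 'l a module. *)
lemma vector_space_ext_scale:
  assumes "field_embedding \<iota>"
  shows "vector_space (ext_scale \<iota>)"
  using assms by unfold_locales (auto simp: field_embedding_def ext_scale_def algebra_simps)

(* The index type 'm orders the basis, so that coordinate vectors live in 'k^'m. *)
definition ext_basis :: "('k::field \<Rightarrow> 'l::field) \<Rightarrow> ('m::finite \<Rightarrow> 'l) \<Rightarrow> bool" where
  "ext_basis \<iota> \<Gamma> \<longleftrightarrow>
     inj \<Gamma> \<and> \<not> module.dependent (ext_scale \<iota>) (range \<Gamma>) \<and>
     module.span (ext_scale \<iota>) (range \<Gamma>) = UNIV"

definition Mat :: "('k::field \<Rightarrow> 'l::field) \<Rightarrow> ('m::finite \<Rightarrow> 'l) \<Rightarrow> 'l^'n::finite \<Rightarrow> 'k^'n^'m" where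
  "Mat \<iota> \<Gamma> x = (\<chi> i j. module.representation (ext_scale \<iota>) (range \<Gamma>) (x $ j) (\<Gamma> i))"

lemma Mat_coordinates:
  assumes "field_embedding \<iota>" "ext_basis \<iota> \<Gamma>"
  shows "x $ j = (\<Sum>i\<in>UNIV. \<iota> (Mat \<iota> \<Gamma> x $ i $ j) * \<Gamma> i)"
proof -
  interpret V: vector_space "ext_scale \<iota>"
    by (rule vector_space_ext_scale[OF assms(1)])
  have b: "inj \<Gamma>" "V.independent (range \<Gamma>)" "V.span (range \<Gamma>) = UNIV"
    using assms(2) by (auto simp: ext_basis_def)
  have "x $ j = (\<Sum>v\<in>range \<Gamma>. ext_scale \<iota> (V.representation (range \<Gamma>) (x $ j) v) v)"
    using V.sum_representation_eq[of "range \<Gamma>" "x $ j" "range \<Gamma>"] b by simp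
  also have "\<dots> = (\<Sum>i\<in>UNIV. \<iota> (Mat \<iota> \<Gamma> x $ i $ j) * \<Gamma> i)"
    by (subst sum.reindex[OF b(1)]) (simp add: Mat_def ext_scale_def)
  finally show ?thesis .
qed

definition supp :: "('k::field \<Rightarrow> 'l::field) \<Rightarrow> ('m::finite \<Rightarrow> 'l) \<Rightarrow> 'l^'n::finite \<Rightarrow> ('k^'n) set" where
  "supp \<iota> \<Gamma> x = vec.span (rows (Mat \<iota> \<Gamma> x))"

definition rk :: "('k::field \<Rightarrow> 'l::field) \<Rightarrow> ('m::finite \<Rightarrow> 'l) \<Rightarrow> 'l^'n::finite \<Rightarrow> nat" where
  "rk \<iota> \<Gamma> x = vec.dim (supp \<iota> \<Gamma> x)"

(* The minimum is over a finite set, nonempty because k >= 1. *)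
definition rank_metric_code ::
  "('k::{field,finite} \<Rightarrow> 'l::{field,finite}) \<Rightarrow> ('m::finite \<Rightarrow> 'l) \<Rightarrow>
   nat \<Rightarrow> nat \<Rightarrow> nat \<Rightarrow> nat \<Rightarrow> nat \<Rightarrow> ('l^'n::finite) set \<Rightarrow> bool" where
  "rank_metric_code \<iota> \<Gamma> q m n k d C \<longleftrightarrow>
     CARD('k) = q \<and> CARD('l) = q ^ m \<and> CARD('n) = n \<and>
     vec.subspace C \<and> vec.dim C = k \<and> 1 \<le> k \<and> d = Min (rk \<iota> \<Gamma> ` (C - {0}))"

definition rank_metric_intersecting ::
  "('k::field \<Rightarrow> 'l::field) \<Rightarrow> ('m::finite \<Rightarrow> 'l) \<Rightarrow> ('l^'n::finite) set \<Rightarrow> bool" where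
  "rank_metric_intersecting \<iota> \<Gamma> C \<longleftrightarrow>
     (\<forall>c\<in>C - {0}. \<forall>c'\<in>C - {0}. supp \<iota> \<Gamma> c \<inter> supp \<iota> \<Gamma> c' \<noteq> {0})"

end

theory Submission
  imports Defs
begin

text \<open>Supports of nonzero codewords are subspaces of an \<open>n\<close>-dimensional space
  over \<open>'k\<close>, each of dimension at least \<open>d\<close>. By
  \<open>dim_sum_le_of_Int_zero\<close>, two that meet trivially would give
  \<open>2 * d \<le> n\<close>.\<close>

lemma dim_sum_le_of_Int_zero:
  fixes U V :: "('k::field^'n::finite) set"
  assumes "vec.subspace U" "vec.subspace V" "U \<inter> V = {0}"
  shows "vec.dim U + vec.dim V \<le> CARD('n)"
proof -
  \<comment> \<open>Grassmann's formula; a trivial intersection contributes dimension 0.\<close>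
  have "vec.dim {x + y |x y. x \<in> U \<and> y \<in> V} + vec.dim (U \<inter> V) = vec.dim U + vec.dim V"
    using assms(1,2) by (rule vec.dim_sums_Int)
  moreover have "vec.dim {x + y |x y. x \<in> U \<and> y \<in> V} \<le> CARD('n)"
    by (rule order_trans[OF vec.dim_subset_UNIV]) (simp add: vec.dimension_def card_cart_basis)
  ultimately show ?thesis
    using assms(3) by simp
qed

theorem theorem2p5:
  fixes \<iota> :: "'k::{field,finite} \<Rightarrow> 'l::{field,finite}"
    and \<Gamma> :: "'m::finite \<Rightarrow> 'l"
    and C :: "('l^'n::finite) set"
    and q m n k d :: nat
  assumes "field_embedding \<iota>"
    and "ext_basis \<iota> \<Gamma>"
    and "rank_metric_code \<iota> \<Gamma> q m n k d C"
    and "2 * d > n"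
  shows "rank_metric_intersecting \<iota> \<Gamma> C"
proof -
  have n: "CARD('n) = n" and d: "d = Min (rk \<iota> \<Gamma> ` (C - {0}))"
    using assms(3) by (auto simp: rank_metric_code_def)
  have d_le: "d \<le> vec.dim (supp \<iota> \<Gamma> c)" if "c \<in> C - {0}" for c
    \<comment> \<open>\<open>Min\<close> bounds every rank from below because \<open>C\<close> is
      finite, the field \<open>'l\<close> being finite.\<close>
    unfolding d rk_def[symmetric] using that by (intro Min_le) auto
  have "supp \<iota> \<Gamma> c \<inter> supp \<iota> \<Gamma> c' \<noteq> {0}"
    if "c \<in> C - {0}" "c' \<in> C - {0}" for c c'
  proof
    assume "supp \<iota> \<Gamma> c \<inter> supp \<iota> \<Gamma> c' = {0}"
    then have "vec.dim (supp \<iota> \<Gamma> c) + vec.dim (supp \<iota> \<Gamma> c') \<le> n"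
      \<comment> \<open>Written as spans of matrix rows, the supports are visibly subspaces.\<close>
      unfolding n[symmetric] supp_def
      by (intro dim_sum_le_of_Int_zero vec.subspace_span)
    with d_le[OF that(1)] d_le[OF that(2)] assms(4) show False
      by linarith
  qed
  then show ?thesis
    by (simp add: rank_metric_intersecting_def)
qed

end
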